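(* For every positive integer $i$ there exist positive integers $n, a, \beta$ such that $$a=\frac{(\beta-3)n+2\beta}{3},\qquad \beta=3(2i-1)$$ (so $\beta\equiv 3 \pmod 6$), and $$N:=n^{3}+(n+1)^{3}=(n+a)^{3}-(n+a-\beta)^{3},$$ where, with the integer $b$ defined by $n+b=-(n+a)+\beta$ (so that $N=n^3+(n+1)^3=(n+a)^3+(n+b)^3$), these quantities are given by $$n=\frac{9(2i-1)^{3}-1}{2},$$ $$N=\frac{27(2i-1)^{3}\left(27(2i-1)^{6}+1\right)}{4},$$ $$n+a=\frac{3(2i-1)\left(3(2i-1)^{3}+1\right)}{2},$$ $$n+b=-\frac{3(2i-1)\left(3(2i-1)^{3}-1\right)}{2}.$$ In particular, this gives an infinite family (indexed by $i$, i.e. by $\beta\equiv 3 \pmod 6$) of solutions of $n^{3}+(n+1)^{3}=(n+a)^{3}-(n+a-\beta)^{3}$.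
   Context: The problem is to find positive integers $N$ that can be written both as a sum of two consecutive cubes $n^3+(n+1)^3$ and as a sum of two other integer cubes $(n+a)^3+(n+b)^3$, with $a>0$ and $b<0$ integers. One sets $n+b=-(n+a)+\beta$, i.e. $\beta=2n+a+b$. *)

theory Defs
  imports Complex_Main "HOL-Number_Theory.Cong"
begin

definition cube_solution :: "int \<Rightarrow> int \<Rightarrow> int \<Rightarrow> bool" where
  "cube_solution n a \<beta> \<longleftrightarrow>
     n > 0 \<and> a > 0 \<and> \<beta> > 0 \<and>
     n ^ 3 + (n + 1) ^ 3 = (n + a) ^ 3 - (n + a - \<beta>) ^ 3"

text \<open>The quotients are taken in the reals, so each closed form also asserts that the
  division is exact.\<close>

definition family_member ::
  "int \<Rightarrow> int \<Rightarrow> int \<Rightarrow> int \<Rightarrow> int \<Rightarrow> int \<Rightarrow> bool" where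
  "family_member i n a \<beta> b N \<longleftrightarrow>
     cube_solution n a \<beta> \<and>
     real_of_int a = ((real_of_int \<beta> - 3) * real_of_int n + 2 * real_of_int \<beta>) / 3 \<and>
     \<beta> = 3 * (2 * i - 1) \<and> [\<beta> = 3] (mod 6) \<and>
     n + b = - (n + a) + \<beta> \<and> b < 0 \<and>
     N = n ^ 3 + (n + 1) ^ 3 \<and>
     N = (n + a) ^ 3 - (n + a - \<beta>) ^ 3 \<and>
     N = (n + a) ^ 3 + (n + b) ^ 3 \<and>
     real_of_int n = (9 * (2 * real_of_int i - 1) ^ 3 - 1) / 2 \<and>
     real_of_int N =
       27 * (2 * real_of_int i - 1) ^ 3 * (27 * (2 * real_of_int i - 1) ^ 6 + 1) / 4 \<and>
     real_of_int (n + a) =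
       3 * (2 * real_of_int i - 1) * (3 * (2 * real_of_int i - 1) ^ 3 + 1) / 2 \<and>
     real_of_int (n + b) =
       - (3 * (2 * real_of_int i - 1) * (3 * (2 * real_of_int i - 1) ^ 3 - 1) / 2)"

definition solution_family :: "(int \<times> int \<times> int) set" where
  "solution_family = {(n, a, \<beta>). \<exists>i > 0. \<exists>b N. family_member i n a \<beta> b N}"

end

(* With m = 2 * i - 1, the closed forms for n and n + a turn the cubic equation into a
   polynomial identity in m. As m is odd, substituting m = 2 * k + 1 clears all denominators,
   and everything becomes an identity between integer polynomials in k. *)
theory Submission
  imports Defs
begin

lemma family_member_exists:
  fixes i :: int
  assumes "i > 0"
  shows "\<exists>n a b N. family_member i n a (3 * (2 * i - 1)) b N"
proof -
  define k where "k = i - 1"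
  have i: "i = k + 1" and k: "k \<ge> 0"
    using assms by (auto simp: k_def)
  \<comment> \<open>This is (9 * m ^ 3 - 1) / 2 expanded at m = 2 * k + 1. With
    \<open>\<beta>\<close> = 6 * k + 3, the quotient ((\<open>\<beta>\<close> - 3) * n + 2 *
    \<open>\<beta>\<close>) / 3 becomes the polynomial chosen for \<open>a\<close>.\<close>
  define n where "n = 36 * k ^ 3 + 54 * k ^ 2 + 27 * k + 4"
  define a where "a = 2 * k * n + 4 * k + 2"
  define \<beta> where "\<beta> = 6 * k + 3"
  define b where "b = \<beta> - a - 2 * n"
  define N where "N = n ^ 3 + (n + 1) ^ 3"
  \<comment> \<open>All coefficients in k are nonnegative and the constant terms of
    \<open>n\<close>, \<open>a\<close> and \<open>\<beta>\<close> are positive, so k \<ge> 0 settles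
    the signs.\<close>
  have pos: "n > 0" "k * n \<ge> 0"
    using k by (simp_all add: n_def add_nonneg_pos)
  then have "a > 0" "\<beta> > 0"
    using k by (simp_all add: a_def \<beta>_def add_nonneg_pos)
  moreover have "b < 0"
  proof -
    \<comment> \<open>Here b = 2 * k + 1 - 2 * (k * n) - 2 * n. A linear lower bound on
      \<open>n\<close> makes the last term outweigh 2 * k + 1; with k * n treated as one nonnegative
      atom the rest is linear.\<close>
    have "27 * k \<le> n - 4"
      using k by (simp add: n_def)
    then show ?thesis
      using pos k unfolding b_def a_def \<beta>_def mult.assoc by linarith
  qed
  moreover have cubes: "N = (n + a) ^ 3 - (n + a - \<beta>) ^ 3"
    unfolding N_def a_def \<beta>_def n_def by algebra
  \<comment> \<open>By the choice of \<open>b\<close>, n + b = -(n + a - \<open>\<beta>\<close>),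
    and cubing is odd.\<close>
  moreover have "N = (n + a) ^ 3 + (n + b) ^ 3"
    unfolding cubes b_def by algebra
  moreover have "[\<beta> = 3] (mod 6)"
    by (simp add: \<beta>_def cong_iff_dvd_diff)
  moreover have
    "real_of_int a = ((real_of_int \<beta> - 3) * real_of_int n + 2 * real_of_int \<beta>) / 3"
    by (simp add: a_def \<beta>_def field_simps)
  moreover have "real_of_int n = (9 * (2 * real_of_int i - 1) ^ 3 - 1) / 2"
    by (simp add: n_def i power2_eq_square power3_eq_cube algebra_simps)
  moreover have "real_of_int N =
      27 * (2 * real_of_int i - 1) ^ 3 * (27 * (2 * real_of_int i - 1) ^ 6 + 1) / 4"
  proof -
    \<comment> \<open>With the denominator cleared this is a ring identity over the integers, within
      reach of \<open>algebra\<close>; casting it to the reals and dividing gives the quotient form.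
      The closed forms of n + a and n + b are treated alike.\<close>
    have "4 * N = 27 * (2 * i - 1) ^ 3 * (27 * (2 * i - 1) ^ 6 + 1)"
      unfolding N_def n_def i by algebra
    from arg_cong[OF this, of real_of_int] show ?thesis
      by simp
  qed
  moreover have "real_of_int (n + a) =
      3 * (2 * real_of_int i - 1) * (3 * (2 * real_of_int i - 1) ^ 3 + 1) / 2"
  proof -
    have "2 * (n + a) = 3 * (2 * i - 1) * (3 * (2 * i - 1) ^ 3 + 1)"
      unfolding a_def n_def i by algebra
    from arg_cong[OF this, of real_of_int] show ?thesis
      by simp
  qed
  moreover have "real_of_int (n + b) =
      - (3 * (2 * real_of_int i - 1) * (3 * (2 * real_of_int i - 1) ^ 3 - 1) / 2)"
  proof -
    have "2 * (n + b) = - (3 * (2 * i - 1) * (3 * (2 * i - 1) ^ 3 - 1))"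
      unfolding b_def \<beta>_def a_def n_def i by algebra
    from arg_cong[OF this, of real_of_int] show ?thesis
      by simp
  qed
  moreover have "\<beta> = 3 * (2 * i - 1)" "n + b = - (n + a) + \<beta>"
    by (simp_all add: \<beta>_def i b_def)
  ultimately have "family_member i n a \<beta> b N"
    unfolding family_member_def cube_solution_def using pos(1) N_def by (intro conjI) (assumption | simp)+
  then show ?thesis
    using \<open>\<beta> = 3 * (2 * i - 1)\<close> by auto
qed

text \<open>The equation \<open>\<beta>\<close> = 3 * (2 * i - 1) recovers the index, the closed
  form in the index then fixes \<open>n\<close>, and \<open>n\<close> together with
  \<open>\<beta>\<close> fixes \<open>a\<close>.\<close>

lemma family_member_unique:
  assumes "family_member i n a \<beta> b N" "family_member j n' a' \<beta> b' N'"
  shows "n = n'" "a = a'"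
proof -
  have "i = j"
    using assms by (simp add: family_member_def)
  then have "real_of_int n = real_of_int n'"
    using assms unfolding family_member_def by metis
  then show "n = n'"
    by simp
  then have "real_of_int a = real_of_int a'"
    using assms unfolding family_member_def by metis
  then show "a = a'"
    by simp
qed

text \<open>Labelling solutions by \<open>\<beta>\<close> instead of \<open>i\<close> shows that
  none coincide, so the family inherits the infinitude of the residue class.\<close>

lemma bij_betw_solution_family:
  "bij_betw (\<lambda>(n, a, \<beta>). \<beta>) solution_family {\<beta>. \<beta> > 0 \<and> [\<beta> = 3] (mod 6)}"
proof (rule bij_betw_imageI)
  show "inj_on (\<lambda>(n, a, \<beta>). \<beta>) solution_family"
    by (auto simp: inj_on_def solution_family_def dest: family_member_unique)
  show "(\<lambda>(n, a, \<beta>). \<beta>) ` solution_family = {\<beta>. \<beta> > 0 \<and> [\<beta> = 3] (mod 6)}"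
  proof (intro equalityI subsetI)
    fix \<beta> :: int
    assume "\<beta> \<in> (\<lambda>(n, a, \<beta>). \<beta>) ` solution_family"
    then show "\<beta> \<in> {\<beta>. \<beta> > 0 \<and> [\<beta> = 3] (mod 6)}"
      by (auto simp: solution_family_def family_member_def cube_solution_def)
  next
    fix \<beta> :: int
    assume \<beta>: "\<beta> \<in> {\<beta>. \<beta> > 0 \<and> [\<beta> = 3] (mod 6)}"
    \<comment> \<open>Writing \<open>\<beta>\<close> = 6 * q + 3 with q =
      \<open>\<beta> div 6\<close> \<ge> 0, the index is q + 1: the shift by one arises because i =
      1 corresponds to \<open>\<beta>\<close> = 3.\<close>
    then have "\<beta> = 3 * (2 * (\<beta> div 6 + 1) - 1)" "\<beta> div 6 + 1 > 0"
      by (auto simp: cong_def) presburger+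
    then obtain i where i: "\<beta> = 3 * (2 * i - 1)" "i > 0"
      by blast
    then obtain n a b N where "family_member i n a \<beta> b N"
      using family_member_exists by blast
    with i have "(n, a, \<beta>) \<in> solution_family"
      by (auto simp: solution_family_def)
    then show "\<beta> \<in> (\<lambda>(n, a, \<beta>). \<beta>) ` solution_family"
      by force
  qed
qed

lemma infinite_pos_cong_3_mod_6: "infinite {\<beta>::int. \<beta> > 0 \<and> [\<beta> = 3] (mod 6)}"
proof (rule infinite_super)
  show "range (\<lambda>k. 6 * int k + 3) \<subseteq> {\<beta>. \<beta> > 0 \<and> [\<beta> = 3] (mod 6)}"
    by (auto simp: cong_iff_dvd_diff)
  show "infinite (range (\<lambda>k. 6 * int k + 3))"
    by (simp add: finite_image_iff inj_def)
qed

theorem theorem2: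
  "(\<forall>i::int. i > 0 \<longrightarrow> (\<exists>n a \<beta> b N. family_member i n a \<beta> b N)) \<and>
   infinite solution_family \<and>
   solution_family \<subseteq> {(n, a, \<beta>). cube_solution n a \<beta>} \<and>
   bij_betw (\<lambda>(n, a, \<beta>). \<beta>) solution_family {\<beta>. \<beta> > 0 \<and> [\<beta> = 3] (mod 6)}"
proof (intro conjI)
  show "\<forall>i::int. i > 0 \<longrightarrow> (\<exists>n a \<beta> b N. family_member i n a \<beta> b N)"
    using family_member_exists by blast
  show "infinite solution_family"
    using bij_betw_finite[OF bij_betw_solution_family] infinite_pos_cong_3_mod_6 by simp
  show "solution_family \<subseteq> {(n, a, \<beta>). cube_solution n a \<beta>}"
    by (auto simp: solution_family_def family_member_def)
qed (rule bij_betw_solution_family)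

end
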